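(* Let $G$ be a connected $3K_1$-free graph. Then for every two distinct vertices $u,v\in V(G)$, $G$ has a path cover $\mathrm{PC}(u,v)$.
   Context: Graphs are finite, simple and undirected. $3K_1$-free means no independent set of size 3. $\mathrm{PC}(u,v)$ denotes a path cover of size 2 with one path starting at $u$ and the other starting at $v$, i.e., two vertex-disjoint paths (possibly consisting of a single vertex), one with an end-vertex $u$ and the other with an end-vertex $v$, whose vertex sets together cover $V(G)$. *)

theory Defs
  imports "Graph_Theory.Graph_Theory"
begin

text \<open>
  A finite simple undirected graph is a \<^locale>\<open>graph\<close>, that is, a finite symmetric digraph
  without loops and without parallel arcs. An edge \<open>{x, y}\<close> is represented by the two opposite
  arcs, so \<open>x \<rightarrow>\<^bsub>G\<^esub> y\<close> is adjacency.
\<close>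

definition independent_set :: "('a, 'b) pre_digraph \<Rightarrow> 'a set \<Rightarrow> bool" where
  "independent_set G S \<longleftrightarrow> S \<subseteq> verts G \<and> (\<forall>x\<in>S. \<forall>y\<in>S. x \<noteq> y \<longrightarrow> \<not> x \<rightarrow>\<^bsub>G\<^esub> y)"

definition three_K1_free :: "('a, 'b) pre_digraph \<Rightarrow> bool" where
  "three_K1_free G \<longleftrightarrow> (\<nexists>S. independent_set G S \<and> card S = 3)"

text \<open>
  A path is the nonempty list of its vertices (\<^const>\<open>vpath\<close>); the list \<open>[x]\<close> is the
  one-vertex path. A list may be reversed, so an end-vertex can be taken to be its head.
\<close>

definition PC :: "('a, 'b) pre_digraph \<Rightarrow> 'a \<Rightarrow> 'a \<Rightarrow> 'a list \<Rightarrow> 'a list \<Rightarrow> bool" where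
  "PC G u v p q \<longleftrightarrow>
     vpath p G \<and> vpath q G \<and> hd p = u \<and> hd q = v \<and>
     set p \<inter> set q = {} \<and> set p \<union> set q = verts G"

end

theory Submission
  imports Defs
begin

text \<open>
  Among all pairs of disjoint paths starting at \<open>u\<close> and \<open>v\<close>, take one covering as many vertices as
  possible. If it is not a cover, connectedness gives an uncovered vertex \<open>w\<close> with a neighbour \<open>z\<close>
  on, say, the path \<open>p\<close>. By maximality \<open>w\<close> is adjacent to neither of the final vertices of the
  two paths, so these are adjacent to each other, as \<open>G\<close> has no independent set of size 3. Now
  cut \<open>p\<close> after \<open>z\<close>, continue its initial part from \<open>z\<close> to \<open>w\<close>, and append the rest of \<open>p\<close>,
  reversed, to the other path: this covers one more vertex, a contradiction.
\<close>

lemma vpath_append_iff: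
  assumes "p \<noteq> []" "q \<noteq> []"
  shows "vpath (p @ q) G \<longleftrightarrow>
    vpath p G \<and> vpath q G \<and> set p \<inter> set q = {} \<and> last p \<rightarrow>\<^bsub>G\<^esub> hd q"
  using assms by (auto simp: vpath_def vwalk_def vwalk_arcs_append)

lemma vpath_singleton: "vpath [x] G \<longleftrightarrow> x \<in> verts G"
  by (auto simp: vpath_def vwalk_def)

lemma vpath_not_Nil: "vpath p G \<Longrightarrow> p \<noteq> []"
  by (auto simp: vpath_def vwalk_def)

lemma vpath_subset_verts: "vpath p G \<Longrightarrow> set p \<subseteq> verts G"
  by (auto simp: vpath_def vwalk_def)

lemma (in sym_digraph) dominates_commute: "x \<rightarrow>\<^bsub>G\<^esub> y \<longleftrightarrow> y \<rightarrow>\<^bsub>G\<^esub> x"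
  using sym_arcs unfolding symmetric_def by (meson symD)

lemma (in sym_digraph) vpath_rev: "vpath p G \<Longrightarrow> vpath (rev p) G"
proof (induction p)
  case (Cons x p)
  show ?case
  proof (cases "p = []")
    case False
    with Cons have "vpath p G" "x \<in> verts G" "x \<notin> set p" "x \<rightarrow>\<^bsub>G\<^esub> hd p"
      using vpath_append_iff[of "[x]" p G] by (auto simp: vpath_singleton)
    with False Cons.IH show ?thesis
      by (simp add: vpath_append_iff vpath_singleton last_rev dominates_commute)
  qed (use Cons in simp)
qed (auto simp: vpath_def)

text \<open>This is \<open>PC\<close> without the covering condition: the objects among which a pair
  of largest coverage is chosen.\<close>

definition path_pair :: "('a, 'b) pre_digraph \<Rightarrow> 'a \<Rightarrow> 'a \<Rightarrow> 'a list \<Rightarrow> 'a list \<Rightarrow> bool" where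
  "path_pair G u v p q \<longleftrightarrow>
     vpath p G \<and> vpath q G \<and> hd p = u \<and> hd q = v \<and> set p \<inter> set q = {}"

lemma path_pair_commute: "path_pair G u v p q \<longleftrightarrow> path_pair G v u q p"
  by (auto simp: path_pair_def)

text \<open>Write \<open>p = xs @ z # ys\<close>. The new paths are \<open>xs @ [z, w]\<close> and
  \<open>q @ rev ys\<close>; the second is joined by the edge between \<open>last q\<close> and
  \<open>last p\<close>. If \<open>z = last p\<close>, then \<open>ys\<close> is empty and no such
  edge is needed.\<close>

lemma (in sym_digraph) path_pair_extend:
  assumes pq: "path_pair G u v p q"
    and z: "z \<in> set p" and zw: "z \<rightarrow>\<^bsub>G\<^esub> w" and w: "w \<notin> set p \<union> set q"
    and ends: "z = last p \<or> last p \<rightarrow>\<^bsub>G\<^esub> last q"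
  shows "\<exists>p' q'. path_pair G u v p' q' \<and> set p' \<union> set q' = insert w (set p \<union> set q)"
proof -
  have wv: "w \<in> verts G" using zw by (auto dest: adj_in_verts)
  obtain xs ys where p: "p = xs @ z # ys" using z by (auto dest: split_list)
  have path: "vpath p G" and q: "vpath q G" and disj: "set p \<inter> set q = {}"
    and heads: "hd p = u" "hd q = v"
    using pq by (auto simp: path_pair_def)
  have "distinct p" using path by auto
  have "vpath (xs @ [z]) G"
  proof (cases "ys = []")
    case False
    then show ?thesis using path vpath_append_iff[of "xs @ [z]" ys G] p by simp
  qed (use path p in simp)
  then have p': "vpath ((xs @ [z]) @ [w]) G"
    using zw w p wv by (subst vpath_append_iff) (auto simp: vpath_singleton)
  have q': "vpath (q @ rev ys) G"
  proof (cases "ys = []")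
    case False
    then have "vpath ys G"
      using path vpath_append_iff[of "xs @ [z]" ys G] p by simp
    \<comment> \<open>As \<open>ys\<close> is nonempty, \<open>last p\<close> lies in
      \<open>ys\<close>, so distinctness rules out the alternative
      \<open>z = last p\<close>.\<close>
    moreover have "last p \<rightarrow>\<^bsub>G\<^esub> last q"
      using ends False p \<open>distinct p\<close> by auto
    ultimately show ?thesis
      using False p disj vpath_not_Nil[OF q] q
      by (subst vpath_append_iff) (auto simp: hd_rev vpath_rev dominates_commute)
  qed (use q in simp)
  have "path_pair G u v ((xs @ [z]) @ [w]) (q @ rev ys)"
    using p' q' heads p disj w vpath_not_Nil[OF q] \<open>distinct p\<close>
    by (auto simp: path_pair_def hd_append)
  moreover have "set ((xs @ [z]) @ [w]) \<union> set (q @ rev ys) = insert w (set p \<union> set q)"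
    using p by auto
  ultimately show ?thesis by blast
qed

text \<open>A walk that starts in \<open>C\<close> and ends outside must use an arc leaving
  \<open>C\<close>.\<close>

lemma reachable_leaves_set:
  assumes "wf_digraph G" "a \<rightarrow>\<^sup>*\<^bsub>G\<^esub> b" "a \<in> C" "b \<notin> C"
  shows "\<exists>z\<in>C. \<exists>w. w \<notin> C \<and> z \<rightarrow>\<^bsub>G\<^esub> w"
  using assms(2-4)
  by (induction rule: wf_digraph.reachable_induct[OF assms(1), consumes 1]) blast+

lemma (in sym_digraph) connected_leaves_set:
  assumes "connected G" "C \<subseteq> verts G" "C \<noteq> {}" "C \<noteq> verts G"
  shows "\<exists>z\<in>C. \<exists>w. w \<notin> C \<and> z \<rightarrow>\<^bsub>G\<^esub> w"
proof -
  obtain a b where ab: "a \<in> C" "b \<in> verts G" "b \<notin> C" using assms(2-4) by blast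
  \<comment> \<open>Connectedness concerns the symmetric closure; since the arcs of \<open>G\<close>
    are already symmetric, it yields reachability in \<open>G\<close> itself.\<close>
  have "strongly_connected G"
    using symmetric_connected_imp_strongly_connected[OF sym_arcs assms(1)] .
  then have "a \<rightarrow>\<^sup>*\<^bsub>G\<^esub> b"
    using ab assms(2) by (simp add: strongly_connected_def subset_iff)
  then show ?thesis
    using reachable_leaves_set[OF wf_digraph] ab(1,3) by metis
qed

lemma (in sym_digraph) three_K1_freeD:
  assumes "three_K1_free G" "x \<in> verts G" "y \<in> verts G" "w \<in> verts G"
    and "x \<noteq> y" "w \<noteq> x" "w \<noteq> y"
  shows "x \<rightarrow>\<^bsub>G\<^esub> y \<or> x \<rightarrow>\<^bsub>G\<^esub> w \<or> y \<rightarrow>\<^bsub>G\<^esub> w"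
proof (rule ccontr)
  assume "\<not> ?thesis"
  then have "independent_set G {x, y, w}"
    using assms by (auto simp: independent_set_def dominates_commute)
  moreover have "card {x, y, w} = 3" using assms by simp
  ultimately show False using assms(1) unfolding three_K1_free_def by blast
qed

lemma (in pseudo_graph) path_pair_not_cover_extend:
  assumes "connected G" "three_K1_free G"
    and pq: "path_pair G u v p q" and "set p \<union> set q \<noteq> verts G"
  shows "\<exists>p' q' w. path_pair G u v p' q' \<and> w \<notin> set p \<union> set q \<and>
    set p' \<union> set q' = insert w (set p \<union> set q)"
proof -
  have qp: "path_pair G v u q p" using pq path_pair_commute by metis
  have ne: "p \<noteq> []" "q \<noteq> []" and sub: "set p \<subseteq> verts G" "set q \<subseteq> verts G"
    and disj: "set p \<inter> set q = {}"
    using pq by (auto simp: path_pair_def dest: vpath_not_Nil vpath_subset_verts)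
  have "set p \<union> set q \<subseteq> verts G" "set p \<union> set q \<noteq> {}"
    using ne sub by auto
  then obtain z w where z: "z \<in> set p \<union> set q" and w: "w \<notin> set p \<union> set q" and zw: "z \<rightarrow>\<^bsub>G\<^esub> w"
    using connected_leaves_set[OF assms(1)] assms(4) by metis
  have wv: "w \<in> verts G" using zw by (auto dest: adj_in_verts)
  have ends: "last p \<in> set p" "last q \<in> set q" using ne by auto
  then have "last p \<rightarrow>\<^bsub>G\<^esub> last q \<or> last p \<rightarrow>\<^bsub>G\<^esub> w \<or> last q \<rightarrow>\<^bsub>G\<^esub> w"
    using three_K1_freeD[OF assms(2), of "last p" "last q" w] sub disj w wv by (metis IntI UnI1 UnI2 empty_iff subsetD)
  \<comment> \<open>If the last vertices are adjacent, \<open>y\<close> is the vertex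
    \<open>z\<close> found above. Otherwise \<open>y\<close> is a last vertex adjacent to
    \<open>w\<close>, and its path is simply prolonged by \<open>w\<close>. The second case is the
    first for the swapped pair \<open>qp\<close>.\<close>
  then consider y where "y \<in> set p" "y \<rightarrow>\<^bsub>G\<^esub> w" "y = last p \<or> last p \<rightarrow>\<^bsub>G\<^esub> last q"
    | y where "y \<in> set q" "y \<rightarrow>\<^bsub>G\<^esub> w" "y = last q \<or> last q \<rightarrow>\<^bsub>G\<^esub> last p"
    using ends z zw dominates_commute[of "last p" "last q"] by (metis Un_iff)
  then show ?thesis
  proof cases
    case 1
    then show ?thesis using path_pair_extend[OF pq 1(1,2) w 1(3)] w by metis
  next
    case 2
    have "w \<notin> set q \<union> set p" using w by blast
    from path_pair_extend[OF qp 2(1,2) this 2(3)] obtain p' q'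
      where "path_pair G u v p' q'" "set p' \<union> set q' = insert w (set p \<union> set q)"
      using path_pair_commute by (metis Un_commute)
    then show ?thesis using w by metis
  qed
qed

theorem theorem10:
  fixes G :: "('a, 'b) pre_digraph"
  assumes "graph G"
    and "connected G"
    and "three_K1_free G"
  shows "\<forall>u \<in> verts G. \<forall>v \<in> verts G. u \<noteq> v \<longrightarrow> (\<exists>p q. PC G u v p q)"
proof (intro ballI impI)
  fix u v
  assume uv: "u \<in> verts G" "v \<in> verts G" "u \<noteq> v"
  interpret graph G by fact
  let ?P = "\<lambda>(p, q). path_pair G u v p q"
  let ?f = "\<lambda>(p, q). card (set p \<union> set q)"
  \<comment> \<open>The two one-vertex paths show that some pair exists, and coverage is bounded by
    the number of vertices, so a maximum is attained.\<close>
  have "?P ([u], [v])"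
    using uv by (simp add: path_pair_def vpath_singleton)
  moreover have "\<forall>r. ?P r \<longrightarrow> ?f r < Suc (card (verts G))"
    by (auto simp: less_Suc_eq_le path_pair_def dest: vpath_subset_verts intro!: card_mono)
  ultimately obtain p q where pq: "path_pair G u v p q"
    and max: "\<And>p' q'. path_pair G u v p' q' \<Longrightarrow> card (set p' \<union> set q') \<le> card (set p \<union> set q)"
    using ex_has_greatest_nat[of ?P "([u], [v])" ?f "Suc (card (verts G))"] by auto
  have "set p \<union> set q = verts G"
  proof (rule ccontr)
    assume "set p \<union> set q \<noteq> verts G"
    then obtain p' q' w where "path_pair G u v p' q'" "w \<notin> set p \<union> set q"
      "set p' \<union> set q' = insert w (set p \<union> set q)"
      using path_pair_not_cover_extend[OF assms(2,3) pq] by metis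
    then show False using max[of p' q'] by simp
  qed
  then show "\<exists>p q. PC G u v p q"
    using pq by (auto simp: PC_def path_pair_def)
qed

end
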